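(* Let $n,k$ be integers with $1\le k\le n$. (i) $S(n,k)$ is a MZC if and only if $[n-k]\cap[n]=\emptyset$. (ii) $S(n,k)$ is a SMZC if and only if $[n-k]\cap[n-1]=\emptyset$. (iii) $S(n,k)$ is an AMZC if and only if $[n-k]\cap[n]\neq\emptyset$ and precisely one of the following conditions holds: (a) $\nu\binom{n+n-k}{n} = \#([n]\cap[n-k])$; (b) $\nu\binom{n+n-k-1}{n} = \#([n]\cap[n-k])-1$; (c) $n-k$ is odd and $\nu\binom{n+n-k-2}{n} = \#([n]\cap[n-k])-1$. (iv) $S(n,k)$ is a SAMZC if and only if $[n-k]\cap[n-1]\neq\emptyset$ and precisely one of the following conditions holds: (a) $\nu\binom{n-1+n-k}{n-1} = \#([n-1]\cap[n-k])$; (b) $n-k$ is odd and $\nu\binom{n-1+n-k-2}{n-1} = \#([n-1]\cap[n-k])-1$.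
   Context: $S(n,k)$ denotes the Stirling number of the second kind and $\nu$ the $2$-adic valuation (with $\nu(0)=+\infty$). For a nonnegative integer $m$, $\sigma(m)$ is the sum of the base-$2$ digits of $m$ and $[m]$ is the set of powers of $2$ in the base-$2$ expansion of $m$. Terminology: $S(n,k)$ is a MZC (minimum zero case) if $\nu(S(n,k))=\sigma(k)-\sigma(n)$; an AMZC (almost minimum zero case) if it is not a MZC and $\nu(S(n,k))=\sigma(k)-\sigma(n)+\#([n]\cap[n-k])$; a SMZC (shifted minimum zero case) if $\nu(S(n,k))=\sigma(k-1)-\sigma(n-1)$; a SAMZC (shifted almost minimum zero case) if it is not a SMZC and $\nu(S(n,k))=\sigma(k-1)-\sigma(n-1)+\#([n-1]\cap[n-k])$. *)

theory Defs
  imports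
    "HOL-Library.Extended"
    "HOL-Computational_Algebra.Primes"
    "HOL-Combinatorics.Stirling"
begin

text \<open>The extended integers are used because the values compared with a valuation may be
  negative, while the valuation of 0 is infinite (the library's \<open>multiplicity 2 0\<close> is 0).\<close>

definition nu :: "nat \<Rightarrow> int extended" where
  "nu m = (if m = 0 then Pinf else Fin (int (multiplicity 2 m)))"

fun sigma :: "nat \<Rightarrow> nat" where
  "sigma m = (if m = 0 then 0 else m mod 2 + sigma (m div 2))"

declare sigma.simps [simp del]

definition binpows :: "nat \<Rightarrow> nat set" where
  "binpows m = {2 ^ i | i. bit m i}"

definition common :: "nat \<Rightarrow> nat \<Rightarrow> int" where
  "common a b = int (card (binpows a \<inter> binpows b))"

text \<open>The following notions concern the pair of indices \<open>(n, k)\<close>, not the number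
  \<open>Stirling n k\<close>; they are meant for \<open>1 \<le> k \<le> n\<close>, where the natural-number subtractions
  do not truncate. \<open>Stirling\<close> is the library's Stirling number of the second kind
  (\<open>stirling\<close> is the first kind).\<close>

definition MZC :: "nat \<Rightarrow> nat \<Rightarrow> bool" where
  "MZC n k \<longleftrightarrow> nu (Stirling n k) = Fin (int (sigma k) - int (sigma n))"

definition AMZC :: "nat \<Rightarrow> nat \<Rightarrow> bool" where
  "AMZC n k \<longleftrightarrow> \<not> MZC n k \<and>
     nu (Stirling n k) = Fin (int (sigma k) - int (sigma n) + common n (n - k))"

definition SMZC :: "nat \<Rightarrow> nat \<Rightarrow> bool" where
  "SMZC n k \<longleftrightarrow> nu (Stirling n k) = Fin (int (sigma (k - 1)) - int (sigma (n - 1)))"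

definition SAMZC :: "nat \<Rightarrow> nat \<Rightarrow> bool" where
  "SAMZC n k \<longleftrightarrow> \<not> SMZC n k \<and>
     nu (Stirling n k) =
       Fin (int (sigma (k - 1)) - int (sigma (n - 1)) + common (n - 1) (n - k))"

text \<open>\<open>precisely_one\<close> counts positions in the list, so two conditions that both hold are
  counted twice even though they are equal as truth values.\<close>

definition precisely_one :: "bool list \<Rightarrow> bool" where
  "precisely_one Ps \<longleftrightarrow> (\<exists>!i. i < length Ps \<and> Ps ! i)"

end

theory Submission
  imports Defs "HOL-Computational_Algebra.Formal_Power_Series"
begin

text \<open>
  Write \<open>L(u) = log (1 + 2 u) / (2 u)\<close>, a power series with 2-integral coefficients, and
  \<open>d = n - k\<close>. Lagrange inversion of \<open>(exp t - 1) ^ k\<close> gives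
  \<open>S(n, k) = n! / (k! 2^d) * [u^d] L^(-n-1) / (1 + 2 u) = (n-1)! / ((k-1)! 2^d) * [u^d] L^(-n)\<close>,
  where the prefactors have valuations \<open>\<sigma>(k) - \<sigma>(n)\<close> and \<open>\<sigma>(k-1) - \<sigma>(n-1)\<close> by
  Legendre's formula. So everything depends on the valuations of the two coefficients.

  Writing \<open>L = 1 - u (1 + y\<^sub>1 u + y\<^sub>2 u^2 + \<dots>)\<close>, the valuation of \<open>y\<^sub>i\<close> exceeds \<open>\<sigma>(i)\<close>
  except for \<open>i = 2\<close>, where \<open>y\<^sub>2 = 2\<close>. Since moving from \<open>d - i\<close> to \<open>d\<close> raises the number \<open>r\<close> of
  binary digits shared with \<open>N\<close> by at most \<open>\<sigma>(i)\<close>, only two terms of the binomial expansion of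
  \<open>L^(-N-1)\<close> survive modulo \<open>2^(r+1)\<close>:
  \<open>binom(N+d, N) + 2 (d-2) binom(N+d-2, N)\<close>. The factor \<open>1 / (1 + 2 u)\<close> adds
  \<open>- 2 binom(n+d-1, n)\<close>. All these terms are divisible by \<open>2^r\<close>, so the valuation is \<open>r\<close> iff an
  odd number of them have valuation exactly \<open>r\<close>.
\<close>

unbundle fps_syntax

subsection \<open>Binary digit sums\<close>

lemma sigma_0 [simp]: "sigma 0 = 0"
  by (simp add: sigma.simps)

lemma sigma_double [simp]: "sigma (2 * m) = sigma m"
  by (cases "m = 0") (simp_all add: sigma.simps [of "2 * m"])

lemma sigma_Suc_double [simp]: "sigma (Suc (2 * m)) = Suc (sigma m)"
  by (simp add: sigma.simps [of "Suc (2 * m)"])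

lemma sigma_1 [simp]: "sigma (Suc 0) = 1"
  by (simp add: sigma.simps)

lemma sigma_le: "sigma m \<le> m"
proof (induction m rule: less_induct)
  case (less m)
  show ?case
  proof (cases "m = 0")
    case False
    then have "sigma (m div 2) \<le> m div 2"
      using less by simp
    then show ?thesis
      using False by (simp add: sigma.simps [of m])
  qed simp
qed

lemma sigma_less:
  assumes "2 \<le> m"
  shows "sigma m < m"
proof -
  have "sigma (m div 2) \<le> m div 2"
    by (rule sigma_le)
  moreover have "m mod 2 + m div 2 < m"
    using assms by presburger
  ultimately show ?thesis
    using assms by (simp add: sigma.simps [of m])
qed

lemma sigma_pos: "0 < m \<Longrightarrow> 0 < sigma m"
proof (induction m rule: less_induct)
  case (less m)
  then show ?case
    by (cases "m = 1") (auto simp: sigma.simps [of m])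
qed

lemma sigma_eq_0_iff [simp]: "sigma m = 0 \<longleftrightarrow> m = 0"
  using sigma_pos by fastforce

lemma multiplicity_2_odd: "odd m \<Longrightarrow> multiplicity 2 (m :: nat) = 0"
  by (rule not_dvd_imp_multiplicity_0)

lemma multiplicity_2_double:
  "0 < m \<Longrightarrow> multiplicity 2 (2 * m :: nat) = Suc (multiplicity 2 m)"
  by (rule multiplicity_times_same) auto

text \<open>Adding 1 clears the trailing block of ones, whose length is the valuation of
  \<open>Suc m\<close>, and sets the next digit.\<close>

lemma sigma_Suc: "sigma (Suc m) + multiplicity 2 (Suc m) = Suc (sigma m)"
proof (induction m rule: less_induct)
  case (less m)
  show ?case
  proof (cases "even m")
    case True
    then obtain j where "m = 2 * j" ..
    then show ?thesis
      by (simp add: multiplicity_2_odd)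
  next
    case False
    then obtain j where j: "m = Suc (2 * j)"
      by (auto elim: oddE)
    have "multiplicity 2 (2 * Suc j) = Suc (multiplicity 2 (Suc j))"
      by (rule multiplicity_2_double) simp
    moreover have "sigma (2 * Suc j) = sigma (Suc j)"
      by (rule sigma_double)
    ultimately show ?thesis
      using less [of j] by (simp add: j)
  qed
qed

lemma sigma_Suc_le: "sigma (Suc m) \<le> Suc (sigma m)"
  using sigma_Suc [of m] by linarith

text \<open>Legendre's formula at the prime 2, by telescoping \<open>sigma_Suc\<close>; the additive
  form avoids truncated subtraction.\<close>

lemma multiplicity_2_fact: "multiplicity 2 (fact m :: nat) + sigma m = m"
proof (induction m)
  case (Suc m)
  have "multiplicity 2 (fact (Suc m) :: nat) = multiplicity 2 (Suc m) + multiplicity 2 (fact m :: nat)"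
    unfolding fact_Suc of_nat_id
    by (rule prime_elem_multiplicity_mult_distrib) auto
  then show ?case
    using sigma_Suc [of m] Suc by linarith
qed simp

section \<open>Carries in binary addition\<close>

lemma and_double_nat:
  fixes a b :: nat
  shows "and (2 * a) (2 * b) = 2 * and a b" "and (2 * a) (Suc (2 * b)) = 2 * and a b"
    "and (Suc (2 * a)) (2 * b) = 2 * and a b" "and (Suc (2 * a)) (Suc (2 * b)) = Suc (2 * and a b)"
  by (simp_all add: and_nat_rec [of "2 * a"] and_nat_rec [of "Suc (2 * a)"])

lemma nat_last_bit:
  obtains m y where "n = 2 * m + y" "y = 0 \<or> y = (1 :: nat)"
  using that [of "n div 2" "n mod 2"] by (cases "even n") (simp_all add: odd_iff_mod_2_eq_one)

text \<open>Each position where both summands have the digit 1 produces a carry, and each carry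
  lowers the digit sum by 1.\<close>

lemma sigma_add_and_le: "sigma (a + b) + sigma (and a b) \<le> sigma a + sigma b"
proof (induction a arbitrary: b rule: less_induct)
  case (less a)
  show ?case
  proof (cases "a = 0")
    case False
    obtain a' y where a: "a = 2 * a' + y" "y = 0 \<or> y = 1"
      by (rule nat_last_bit [of a])
    obtain b' z where b: "b = 2 * b' + z" "z = 0 \<or> z = 1"
      by (rule nat_last_bit [of b])
    have IH: "sigma (a' + b') + sigma (and a' b') \<le> sigma a' + sigma b'"
      using less [of a' b'] a False by auto
    have *: "sigma (2 * a' + 2 * b') = sigma (a' + b')"
      "sigma (Suc (2 * a' + 2 * b')) = Suc (sigma (a' + b'))"
      "sigma (Suc (Suc (2 * a' + 2 * b'))) = sigma (Suc (a' + b'))"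
      using sigma_double [of "a' + b'"] sigma_Suc_double [of "a' + b'"]
        sigma_double [of "Suc (a' + b')"] by simp_all
    show ?thesis
      using a(2) b(2) IH sigma_Suc_le [of "a' + b'"]
      by (auto simp: a(1) b(1) and_double_nat *)
  qed simp
qed

lemma sigma_add_le: "sigma (a + b) \<le> sigma a + sigma b"
  using sigma_add_and_le [of a b] by linarith

lemma sigma_add_disjoint: "and a b = 0 \<Longrightarrow> sigma (a + b) = sigma a + sigma b"
proof (induction a arbitrary: b rule: less_induct)
  case (less a)
  show ?case
  proof (cases "a = 0")
    case False
    obtain a' y where a: "a = 2 * a' + y" "y = 0 \<or> y = 1"
      by (rule nat_last_bit [of a])
    obtain b' z where b: "b = 2 * b' + z" "z = 0 \<or> z = 1"
      by (rule nat_last_bit [of b])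
    have "and a' b' = 0"
      using less.prems a(2) b(2) by (auto simp: a(1) b(1) and_double_nat)
    then have IH: "sigma (a' + b') = sigma a' + sigma b'"
      using less.IH [of a' b'] a False by auto
    have *: "sigma (2 * a' + 2 * b') = sigma (a' + b')"
      "sigma (Suc (2 * a' + 2 * b')) = Suc (sigma (a' + b'))"
      using sigma_double [of "a' + b'"] sigma_Suc_double [of "a' + b'"] by simp_all
    show ?thesis
      using a(2) b(2) less.prems IH
      by (auto simp: a(1) b(1) and_double_nat *)
  qed simp
qed

text \<open>Adding one power of 2 sets a single new digit and otherwise only clears digits, so
  adding \<open>b\<close> creates at most \<open>sigma b\<close> new digits shared with
  \<open>N\<close>. This bounds the divisibility lost in passing from an index \<open>d\<close> to a
  smaller one.\<close>

lemma sigma_and_add_le: "sigma (and N (a + b)) \<le> sigma (and N a) + sigma b"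
proof (induction "a + b" arbitrary: N a b rule: less_induct)
  case less
  obtain N' x where N: "N = 2 * N' + x" "x = 0 \<or> x = 1"
    by (rule nat_last_bit [of N])
  obtain a' y where a: "a = 2 * a' + y" "y = 0 \<or> y = 1"
    by (rule nat_last_bit [of a])
  obtain b' z where b: "b = 2 * b' + z" "z = 0 \<or> z = 1"
    by (rule nat_last_bit [of b])
  show ?case
  proof (cases "y = 1 \<and> z = 1")
    case True
    \<comment> \<open>The carry out of the last position is absorbed into the second summand, which
      is why the induction runs over the sum.\<close>
    have IH: "sigma (and N' (a' + Suc b')) \<le> sigma (and N' a') + sigma (Suc b')"
      using less [of a' "Suc b'" N'] True by (simp add: a b)
    have "a + b = 2 * (a' + Suc b')"
      using True by (simp add: a b)
    then have "sigma (and N (a + b)) = sigma (and N' (a' + Suc b'))"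
      using N by (auto simp only: and_double_nat sigma_double add_0_right add_Suc_right One_nat_def)
    then show ?thesis
      using IH sigma_Suc_le [of b'] N(2) True by (auto simp: N(1) a(1) b(1) and_double_nat)
  next
    case False
    have IH: "sigma (and N' (a' + b')) \<le> sigma (and N' a') + sigma b'"
      using less [of a' b' N'] by (cases "a + b = 0") (auto simp: a b)
    have *: "2 * a' + 2 * b' = 2 * (a' + b')"
      by simp
    show ?thesis
      using IH N(2) a(2) b(2) False
      by (auto simp: N(1) a(1) b(1) and_double_nat * simp del: distrib_left_numeral)
  qed
qed

lemma sigma_and_le_diff: "S \<le> d \<Longrightarrow> sigma (and N d) \<le> sigma (and N S) + sigma (d - S)"
  using sigma_and_add_le [of N S "d - S"] by simp

section \<open>Digit sets and their cardinalities\<close>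

lemma binpows_Int: "binpows a \<inter> binpows b = binpows (and a b)"
  by (auto simp: binpows_def bit_and_iff)

lemma Collect_bit_double:
  fixes m :: nat
  shows "Collect (bit (2 * m)) = Suc ` Collect (bit m)"
    and "Collect (bit (Suc (2 * m))) = insert 0 (Suc ` Collect (bit m))"
proof -
  have "bit (2 * m) i \<longleftrightarrow> i \<in> Suc ` Collect (bit m)"
    and "bit (Suc (2 * m)) i \<longleftrightarrow> i \<in> insert 0 (Suc ` Collect (bit m))" for i
    by (cases i; auto simp: bit_Suc bit_0)+
  then show "Collect (bit (2 * m)) = Suc ` Collect (bit m)"
    and "Collect (bit (Suc (2 * m))) = insert 0 (Suc ` Collect (bit m))"
    by auto
qed

lemma card_Collect_bit: "finite (Collect (bit (m :: nat))) \<and> card (Collect (bit m)) = sigma m"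
proof (induction m rule: less_induct)
  case (less m)
  show ?case
  proof (cases "m = 0")
    case False
    obtain j y where m: "m = 2 * j + y" "y = 0 \<or> y = 1"
      by (rule nat_last_bit [of m])
    have "finite (Collect (bit j)) \<and> card (Collect (bit j)) = sigma j"
      using less False m by auto
    then show ?thesis
      using m(2) by (auto simp: m(1) Collect_bit_double card_image)
  qed simp
qed

lemma card_binpows: "finite (binpows m) \<and> card (binpows m) = sigma m"
proof -
  have "binpows m = (^) 2 ` Collect (bit m)"
    by (auto simp: binpows_def)
  moreover have "inj_on ((^) (2 :: nat)) (Collect (bit m))"
    by (auto intro: inj_onI)
  ultimately show ?thesis
    using card_Collect_bit [of m] by (simp add: card_image)
qed

lemma common_eq: "common a b = int (sigma (and a b))"
  by (simp add: common_def binpows_Int card_binpows)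

lemma binpows_disjoint_iff: "binpows a \<inter> binpows b = {} \<longleftrightarrow> and a b = 0"
  using card_binpows [of "and a b"] by (auto simp: binpows_Int)

subsection \<open>Valuations of rational numbers\<close>

lemma nu_eq_Fin_iff: "nu a = Fin m \<longleftrightarrow> a \<noteq> 0 \<and> int (multiplicity 2 a) = m"
  by (simp add: nu_def)

text \<open>Encodes "2-adic valuation at least \<open>m\<close>". Zero satisfies it for every
  \<open>m\<close>, so \<open>exact2 m 0\<close> never holds, in agreement with
  \<open>nu 0 = Pinf\<close>.\<close>

definition div2 :: "int \<Rightarrow> rat \<Rightarrow> bool" where
  "div2 m x \<longleftrightarrow> (\<exists>a b. odd b \<and> x = 2 powi m * of_int a / of_int b)"

definition exact2 :: "int \<Rightarrow> rat \<Rightarrow> bool" where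
  "exact2 m x \<longleftrightarrow> div2 m x \<and> \<not> div2 (m + 1) x"

lemma div2I: "odd b \<Longrightarrow> x = 2 powi m * of_int a / of_int b \<Longrightarrow> div2 m x"
  unfolding div2_def by blast

lemma div2_0 [simp]: "div2 m 0"
  by (rule div2I [of 1 _ _ 0]) auto

lemma div2_add:
  assumes "div2 m x" "div2 m y"
  shows "div2 m (x + y)"
proof -
  obtain a b a' b' where *: "odd b" "x = 2 powi m * of_int a / of_int b"
    "odd b'" "y = 2 powi m * of_int a' / of_int b'"
    using assms unfolding div2_def by blast
  then have "b \<noteq> 0" "b' \<noteq> 0" by auto
  then show ?thesis
    using * by (intro div2I [of "b * b'" _ _ "a * b' + a' * b"]) (auto simp: field_simps)
qed

lemma div2_minus: "div2 m x \<Longrightarrow> div2 m (- x)"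
  unfolding div2_def by (metis minus_divide_left mult_minus_right of_int_minus)

lemma div2_diff: "div2 m x \<Longrightarrow> div2 m y \<Longrightarrow> div2 m (x - y)"
  using div2_add [of m x "- y"] div2_minus by auto

lemma div2_sum: "(\<And>i. i \<in> I \<Longrightarrow> div2 m (f i)) \<Longrightarrow> div2 m (sum f I)"
  by (induction I rule: infinite_finite_induct) (auto intro: div2_add)

lemma div2_mult:
  assumes "div2 m x" "div2 m' y"
  shows "div2 (m + m') (x * y)"
proof -
  obtain a b a' b' where *: "odd b" "x = 2 powi m * of_int a / of_int b"
    "odd b'" "y = 2 powi m' * of_int a' / of_int b'"
    using assms unfolding div2_def by blast
  then show ?thesis
    by (intro div2I [of "b * b'" _ _ "a * a'"]) (auto simp: power_int_add)
qed

lemma div2_mono: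
  assumes "div2 m x" "m' \<le> m"
  shows "div2 m' x"
proof -
  obtain a b where *: "odd b" "x = 2 powi m * of_int a / of_int b"
    using assms unfolding div2_def by blast
  have "(2 :: rat) powi m = 2 powi m' * 2 powi (m - m')"
    by (simp flip: power_int_add)
  also have "2 powi (m - m') = of_int (2 ^ nat (m - m'))"
    using assms(2) by (simp add: power_int_def)
  finally show ?thesis
    using * by (intro div2I [of b _ _ "2 ^ nat (m - m') * a"]) auto
qed

lemma div2_of_int [simp]: "div2 0 (of_int a)"
  by (rule div2I [of 1 _ _ a]) auto

lemma div2_of_nat [simp]: "div2 0 (of_nat a)"
  using div2_of_int [of "int a"] by simp

lemma div2_powi [simp]: "div2 m (2 powi m)"
  by (rule div2I [of 1 _ _ 1]) auto

lemma div2_1_even: "even a \<Longrightarrow> div2 1 (of_int a)"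
  by (elim evenE) (auto intro!: div2I [of 1 _ _ "a div 2"])

lemma div2_1_of_int_iff: "div2 1 (of_int a) \<longleftrightarrow> even a"
proof
  assume "div2 1 (of_int a)"
  then obtain c b where "odd b" "(of_int a :: rat) = 2 powi 1 * of_int c / of_int b"
    unfolding div2_def by blast
  then have "(of_int (a * b) :: rat) = of_int (2 * c)"
    by (auto simp: field_simps)
  then have "a * b = 2 * c"
    unfolding of_int_eq_iff .
  then show "even a"
    using \<open>odd b\<close> by (metis dvd_triv_left even_mult_iff)
qed (rule div2_1_even)

lemma div2_scale:
  assumes "odd s" "odd t"
  shows "div2 (e + m) (2 powi e * (of_int s / of_int t) * x) \<longleftrightarrow> div2 m x"
proof
  have "div2 e (2 powi e * (of_int s / of_int t))"
    using assms by (intro div2I [of t _ _ s]) auto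
  moreover assume "div2 m x"
  ultimately show "div2 (e + m) (2 powi e * (of_int s / of_int t) * x)"
    by (rule div2_mult)
next
  have "div2 (- e) (2 powi (- e) * (of_int t / of_int s))"
    using assms by (intro div2I [of s _ _ t]) auto
  moreover assume "div2 (e + m) (2 powi e * (of_int s / of_int t) * x)"
  ultimately have "div2 (- e + (e + m))
      (2 powi (- e) * (of_int t / of_int s) * (2 powi e * (of_int s / of_int t) * x))"
    by (rule div2_mult)
  moreover have "s \<noteq> 0" "t \<noteq> 0"
    using assms by auto
  ultimately show "div2 m x"
    by (simp add: power_int_minus mult.assoc [symmetric])
qed

lemma exact2_scale:
  assumes "odd s" "odd t"
  shows "exact2 (e + m) (2 powi e * (of_int s / of_int t) * x) \<longleftrightarrow> exact2 m x"
  using div2_scale [OF assms, of e m x] div2_scale [OF assms, of e "m + 1" x]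
  by (simp add: exact2_def add.assoc)

lemma exact2_odd_iff:
  "exact2 0 (of_int a) \<longleftrightarrow> odd a"
  by (simp add: exact2_def div2_1_of_int_iff)

text \<open>The trailing factor \<open>1\<close> gives the right-hand side the shape required by
  \<open>exact2_scale\<close>.\<close>

lemma exact2_representation:
  "exact2 m x \<longleftrightarrow> (\<exists>a b. odd a \<and> odd b \<and> x = 2 powi m * (of_int a / of_int b) * 1)"
proof
  assume "exact2 m x"
  then obtain a b where *: "odd b" "x = 2 powi m * of_int a / of_int b" "\<not> div2 (m + 1) x"
    unfolding exact2_def div2_def by blast
  have "odd a"
  proof
    assume "even a"
    then have "x = 2 powi (m + 1) * of_int (a div 2) / of_int b"
      using * by (auto simp: power_int_add elim!: evenE)
    then show False
      using * div2I by blast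
  qed
  then show "\<exists>a b. odd a \<and> odd b \<and> x = 2 powi m * (of_int a / of_int b) * 1"
    using * by (intro exI [of _ a] exI [of _ b]) auto
next
  assume "\<exists>a b. odd a \<and> odd b \<and> x = 2 powi m * (of_int a / of_int b) * 1"
  moreover have "exact2 0 1"
    using exact2_odd_iff [of 1] by simp
  ultimately show "exact2 m x"
    using exact2_scale [of _ _ m 0 1] by auto
qed

lemma exact2_mult_iff:
  assumes "exact2 e c"
  shows "exact2 (e + m) (c * x) \<longleftrightarrow> exact2 m x"
  using assms exact2_scale unfolding exact2_representation [of e c] by (metis mult_1_right)

lemma exact2_unique:
  assumes "exact2 m x" "exact2 m' x"
  shows "m = m'"
proof -
  have "\<not> m < m'" "\<not> m' < m"
    using assms div2_mono [of m' x "m + 1"] div2_mono [of m x "m' + 1"] by (auto simp: exact2_def)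
  then show ?thesis by simp
qed

lemma exact2_of_nat_iff: "exact2 m (of_nat a) \<longleftrightarrow> nu a = Fin m"
proof (cases "a = 0")
  case True
  then show ?thesis
    by (simp add: nu_def exact2_def)
next
  case False
  then obtain j where j: "a = 2 ^ multiplicity 2 a * j" "odd j"
    by (metis multiplicity_decompose' one_neq_zero odd_one dvd_refl)
  have "(of_nat a :: rat) = 2 powi int (multiplicity 2 a) * (of_int (int j) / of_int 1) * 1"
    by (subst j(1)) simp
  then have "exact2 (int (multiplicity 2 a)) (of_nat a)"
    unfolding exact2_representation using j(2) by (metis even_of_nat odd_one)
  then show ?thesis
    using exact2_unique by (auto simp: nu_eq_Fin_iff False)
qed

lemma exact2_cong:
  assumes "div2 (m + 1) (x - y)"
  shows "exact2 m x \<longleftrightarrow> exact2 m y"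
proof -
  have *: "exact2 m x" if "exact2 m y" "div2 (m + 1) (x - y)" for x y
    using that div2_add [of m y "x - y"] div2_diff [of "m + 1" x "x - y"]
      div2_mono [of "m + 1" "x - y" m]
    by (auto simp: exact2_def)
  have "div2 (m + 1) (y - x)"
    using div2_minus [OF assms] by simp
  then show ?thesis
    using * assms by blast
qed

text \<open>Two odd numerators over odd denominators add up to an even numerator, so exactness at
  level \<open>m\<close> adds like residues modulo 2. Both criteria obtain their exclusive-or from
  here.\<close>

lemma exact2_add:
  assumes "div2 m x" "div2 m y"
  shows "exact2 m (x + y) \<longleftrightarrow> (exact2 m x \<noteq> exact2 m y)"
proof (cases "exact2 m x \<and> exact2 m y")
  case True
  then obtain a b a' b' where *: "odd a" "odd b" "x = 2 powi m * (of_int a / of_int b)"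
    "odd a'" "odd b'" "y = 2 powi m * (of_int a' / of_int b')"
    unfolding exact2_representation by auto
  have nz: "b \<noteq> 0" "b' \<noteq> 0"
    using * by auto
  have "even (a * b' + a' * b)"
    using * by simp
  then obtain c where c: "a * b' + a' * b = 2 * c" ..
  have "x + y = 2 powi m * of_int (a * b' + a' * b) / of_int (b * b')"
    using * nz by (simp add: field_simps)
  also have "\<dots> = 2 powi (m + 1) * of_int c / of_int (b * b')"
    unfolding c by (simp add: power_int_add)
  finally have "div2 (m + 1) (x + y)"
    using * by (intro div2I [of "b * b'"]) auto
  then show ?thesis
    using True by (simp add: exact2_def)
next
  case False
  then show ?thesis
    using assms exact2_cong [of m "x + y" y] exact2_cong [of m "x + y" x]
    by (auto simp: exact2_def)
qed

lemma div2_numeral_2: "div2 1 2"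
  using div2_powi [of 1] by simp

lemma exact2_odd_of_nat: "odd a \<Longrightarrow> exact2 0 (of_nat a)"
  using exact2_odd_iff [of "int a"] by simp

lemma exact2_numeral_2: "exact2 1 2"
  using exact2_of_nat_iff [of 1 2] multiplicity_2_double [of 1] by (simp add: nu_def)

lemma exact2_minus: "exact2 m (- x) \<longleftrightarrow> exact2 m x"
  using div2_minus [of _ x] div2_minus [of _ "- x"] by (auto simp: exact2_def)

subsection \<open>Stirling numbers as coefficients of powers of a logarithmic series\<close>

definition log_series :: "rat fps" where
  "log_series = Abs_fps (\<lambda>j. (-2) ^ j / of_nat (Suc j))"

lemma log_series_nth_0 [simp]: "log_series $ 0 = 1"
  by (simp add: log_series_def)

definition geom_series :: "rat fps" where
  "geom_series = Abs_fps (\<lambda>j. (-2) ^ j)"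

lemma geom_series_mult: "geom_series * (1 + 2 * fps_X) = 1"
proof (rule fps_ext)
  fix j
  show "(geom_series * (1 + 2 * fps_X)) $ j = 1 $ j"
    by (cases j) (simp_all add: geom_series_def distrib_left numeral_fps_const mult.assoc [symmetric])
qed

text \<open>The left side is the derivative of \<open>fps_X * log_series\<close>, that is, of log (1
  + 2 u) / 2.\<close>

lemma log_series_deriv: "log_series + fps_X * fps_deriv log_series = geom_series"
proof (rule fps_ext)
  fix j
  have "(log_series + fps_X * fps_deriv log_series) $ j = of_nat (Suc j) * log_series $ j"
    by (cases j) (simp_all add: distrib_right)
  then show "(log_series + fps_X * fps_deriv log_series) $ j = geom_series $ j"
    by (simp add: geom_series_def log_series_def del: of_nat_Suc)
qed

text \<open>This differential equation replaces Lagrange inversion: it links the two coefficient formulas.\<close>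

lemma inverse_log_series_deriv:
  "inverse log_series - fps_X * fps_deriv (inverse log_series) = inverse log_series ^ 2 * geom_series"
proof -
  have "inverse log_series = inverse log_series ^ 2 * log_series"
    by (simp add: power2_eq_square mult.assoc inverse_mult_eq_1)
  then show ?thesis
    by (simp add: fps_inverse_deriv log_series_deriv [symmetric] algebra_simps power2_eq_square)
qed

text \<open>Let M be the inverse of \<open>log_series\<close>. Multiply the differential equation by
  M^(n-1) and use n u M^(n-1) M' = u (M^n)', whose coefficient at \<open>d\<close> is
  \<open>d\<close> times that of M^n.\<close>

lemma nth_inverse_log_series_power:
  assumes "d \<le> n"
  shows "of_nat n * (inverse log_series ^ Suc n * geom_series) $ d = of_nat (n - d) * (inverse log_series ^ n) $ d"
proof (cases n)
  case (Suc m)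
  have "inverse log_series ^ Suc n * geom_series = inverse log_series ^ m * (inverse log_series ^ 2 * geom_series)"
    by (simp add: Suc power2_eq_square mult_ac)
  also have "\<dots> = inverse log_series ^ n - fps_X * (inverse log_series ^ m * fps_deriv (inverse log_series))"
    unfolding inverse_log_series_deriv [symmetric] by (simp add: Suc right_diff_distrib mult_ac)
  finally have "of_nat n * (inverse log_series ^ Suc n * geom_series) =
      of_nat n * inverse log_series ^ n -
        of_nat n * (fps_X * (inverse log_series ^ m * fps_deriv (inverse log_series)))"
    by (simp only: right_diff_distrib)
  moreover have "fps_deriv (inverse log_series ^ n) =
      of_nat n * (inverse log_series ^ m * fps_deriv (inverse log_series))"
    by (simp only: fps_deriv_power Suc diff_Suc_1 fps_of_nat mult_ac)
  ultimately have "of_nat n * (inverse log_series ^ Suc n * geom_series) =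
      of_nat n * inverse log_series ^ n - fps_X * fps_deriv (inverse log_series ^ n)"
    by (simp only: mult.left_commute)
  then have "(fps_const (of_nat n) * (inverse log_series ^ Suc n * geom_series)) $ d =
      (fps_const (of_nat n) * inverse log_series ^ n - fps_X * fps_deriv (inverse log_series ^ n)) $ d"
    by (simp only: fps_of_nat)
  then have "of_nat n * (inverse log_series ^ Suc n * geom_series) $ d =
      of_nat n * (inverse log_series ^ n) $ d - of_nat d * (inverse log_series ^ n) $ d"
    by (cases "d = 0") (simp_all del: power_Suc)
  then show ?thesis
    using assms by (simp only: of_nat_diff left_diff_distrib)
qed (use assms in auto)

lemma nth_inverse_log_series_split:
  "(inverse log_series ^ Suc n) $ Suc d =
     (inverse log_series ^ Suc n * geom_series) $ Suc d + 2 * (inverse log_series ^ Suc n * geom_series) $ d"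
proof -
  have "inverse log_series ^ Suc n = inverse log_series ^ Suc n * geom_series * (1 + 2 * fps_X)"
    by (metis geom_series_mult mult.assoc mult.right_neutral)
  also have "\<dots> =
      inverse log_series ^ Suc n * geom_series + fps_const 2 * (fps_X * (inverse log_series ^ Suc n * geom_series))"
    by (simp add: algebra_simps numeral_fps_const)
  finally show ?thesis
    by (metis fps_add_nth fps_mult_left_const_nth fps_X_mult_nth nat.distinct(1) diff_Suc_1)
qed

text \<open>Induction along the recurrence S(n+1, j+1) = S(n, j) + (j+1) S(n, j+1):
  \<open>nth_inverse_log_series_power\<close> lowers the exponent from n+2 to n+1, and
  \<open>nth_inverse_log_series_split\<close> then yields the two summands.\<close>

lemma Stirling_eq_coeff:
  assumes "k \<le> n"
  shows "of_nat (Stirling n k) * 2 ^ (n - k) * fact k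
    = fact n * (inverse log_series ^ Suc n * geom_series) $ (n - k)"
  using assms
proof (induction n arbitrary: k)
  case 0
  then show ?case
    by (simp add: geom_series_def)
next
  case (Suc n)
  define B where "B n = inverse log_series ^ Suc n * geom_series" for n
  have B: "of_nat (Suc n) * B (Suc n) $ (Suc n - k) = of_nat k * (inverse log_series ^ Suc n) $ (Suc n - k)"
    using nth_inverse_log_series_power [of "Suc n - k" "Suc n"] Suc.prems by (simp add: B_def)
  show ?case
  proof (cases k)
    case 0
    \<comment> \<open>The factor \<open>of_nat k\<close> in \<open>B\<close> is 0, so the
      coefficient vanishes together with the Stirling number.\<close>
    then show ?thesis
      using B by (simp add: B_def)
  next
    case (Suc j)
    show ?thesis
    proof (cases "j = n")
      case True
      then show ?thesis
        using Suc by (simp add: geom_series_def fps_nth_power_0)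
    next
      case False
      define d where "d = n - Suc j"
      have d: "n - j = Suc d" "n - Suc j = d" "Suc n - Suc j = Suc d"
        using False Suc Suc.prems by (auto simp: d_def)
      have "of_nat (Suc n) * B (Suc n) $ Suc d =
          of_nat (Suc j) * (B n $ Suc d + 2 * B n $ d)"
        using B nth_inverse_log_series_split [of n d] by (simp add: B_def Suc d del: of_nat_Suc power_Suc)
      then have "fact n * (of_nat (Suc n) * B (Suc n) $ Suc d) =
          fact n * (of_nat (Suc j) * (B n $ Suc d + 2 * B n $ d))"
        by (simp only:)
      then have "fact (Suc n) * B (Suc n) $ Suc d =
          of_nat (Suc j) * (fact n * B n $ Suc d + 2 * (fact n * B n $ d))"
        by (simp only: fact_Suc distrib_left mult_ac)
      moreover have "of_nat (Stirling n j) * 2 ^ Suc d * fact j = fact n * B n $ Suc d"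
        using Suc.IH [of j] Suc Suc.prems d by (simp add: B_def)
      moreover have "of_nat (Stirling n (Suc j)) * 2 ^ d * fact (Suc j) = fact n * B n $ d"
        using Suc.IH [of "Suc j"] Suc Suc.prems d False by (simp add: B_def)
      moreover have "of_nat (Stirling (Suc n) (Suc j)) * 2 ^ Suc d * fact (Suc j) =
          of_nat (Suc j) * (of_nat (Stirling n j) * 2 ^ Suc d * fact j +
            2 * (of_nat (Stirling n (Suc j)) * 2 ^ d * fact (Suc j)) :: rat)"
        by (simp add: algebra_simps)
      ultimately show ?thesis
        by (simp only: Suc d B_def [symmetric])
    qed
  qed
qed

subsection \<open>Expansion of the negative powers\<close>

definition log_tail :: "rat fps" where
  "log_tail = Abs_fps (\<lambda>i. - ((-2) ^ Suc i) / of_nat (i + 2))"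

lemma log_tail_nth: "log_tail $ 0 = 1" "log_tail $ 1 = - (4 / 3)" "log_tail $ 2 = 2"
  by (simp_all add: log_tail_def numeral_2_eq_2)

lemma log_series_eq: "log_series = 1 - fps_X * log_tail"
proof (rule fps_ext)
  fix j
  show "log_series $ j = (1 - fps_X * log_tail) $ j"
    by (cases j) (simp_all add: log_series_def log_tail_def add.commute)
qed

text \<open>A subadditive lower bound for the valuation of the coefficients of every power of
  \<open>log_tail\<close>.\<close>

definition weight :: "nat \<Rightarrow> nat" where
  "weight i = (if i = 0 then 0 else if i = 2 then 1 else Suc (sigma i))"

lemma sigma_le_weight: "sigma i \<le> weight i"
  by (auto simp: weight_def sigma.simps [of 2] sigma.simps [of 1])

text \<open>Since \<open>sigma\<close> is subadditive, one surplus 1 on the right suffices, and it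
  is present unless both nonzero indices are 2; then 4 has digit sum 1 and equality holds.\<close>

lemma weight_add_le: "weight (i + j) \<le> weight i + weight j"
proof (cases "i = 0 \<or> j = 0 \<or> i + j = 2")
  case True
  then have "i = 0 \<or> j = 0 \<or> i = 1 \<and> j = 1"
    by auto
  then show ?thesis
    by (auto simp: weight_def)
next
  case False
  then have *: "weight (i + j) = Suc (sigma (i + j))"
    by (simp add: weight_def)
  show ?thesis
  proof (cases "i = 2 \<and> j = 2")
    case True
    then show ?thesis
      by (simp add: weight_def sigma.simps [of 4] sigma.simps [of 2] sigma.simps [of 1])
  next
    case ij: False
    then have "Suc (sigma i + sigma j) \<le> weight i + weight j"
      using False sigma_le_weight [of i] sigma_le_weight [of j]
      by (cases "i = 2") (auto simp: weight_def)
    then show ?thesis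
      using * sigma_add_le [of i j] by linarith
  qed
qed

text \<open>The coefficient of \<open>log_tail\<close> at \<open>i\<close> has valuation i + 1 minus
  that of i + 2. Equality at \<open>i = 2\<close> forces the exceptional value in
  \<open>weight\<close>.\<close>

lemma weight_bound: "weight i + multiplicity 2 (i + 2) \<le> Suc i"
proof -
  consider "i = 0" | "i = 2" | "odd i" | m where "i = 2 * m" "2 \<le> m"
  proof (cases "odd i")
    case False
    then obtain m where "i = 2 * m"
      by blast
    moreover consider "m = 0" | "m = 1" | "2 \<le> m"
      by linarith
    ultimately show ?thesis
      using that by cases auto
  qed (use that in blast)
  then show ?thesis
  proof cases
    case 1
    have "multiplicity 2 (2 * 1 :: nat) = 1"
      using multiplicity_2_double [of 1] by simp
    then show ?thesis
      using 1 by (simp add: weight_def numeral_2_eq_2)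
  next
    case 2
    have "multiplicity 2 (2 * 2 :: nat) = 2"
      using multiplicity_2_double [of 2] multiplicity_2_double [of 1] by simp
    then show ?thesis
      using 2 by (simp add: weight_def)
  next
    case 3
    then show ?thesis
      using sigma_le [of i] by (auto simp: weight_def multiplicity_2_odd)
  next
    case 4
    have "multiplicity 2 (2 * Suc m) = Suc (multiplicity 2 (Suc m))"
      by (rule multiplicity_2_double) simp
    moreover have "0 < sigma (Suc m)"
      by (rule sigma_pos) simp
    ultimately show ?thesis
      using 4 sigma_Suc [of m] sigma_less [of m] by (simp add: weight_def)
  qed
qed

lemma log_tail_div2: "div2 (int (weight i)) (log_tail $ i)"
proof -
  obtain j where j: "i + 2 = 2 ^ multiplicity 2 (i + 2) * j" "odd j"
    by (rule multiplicity_decompose' [of "i + 2" 2]) auto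
  define v where "v = multiplicity 2 (i + 2)"
  have v: "v \<le> Suc i"
    using weight_bound [of i] by (simp add: v_def)
  have "(of_nat (i + 2) :: rat) = 2 ^ v * of_nat j"
    unfolding v_def by (subst j(1)) simp
  moreover have "(2 :: rat) ^ Suc i = 2 ^ (Suc i - v) * 2 ^ v"
    using v by (metis le_add_diff_inverse2 power_add)
  ultimately have "log_tail $ i = 2 powi int (Suc i - v) * of_int (- ((-1) ^ Suc i)) / of_int (int j)"
    using j(2) by (auto simp: log_tail_def power_minus [of 2] simp del: of_nat_add power_Suc)
  then have "div2 (int (Suc i - v)) (log_tail $ i)"
    using j(2) by (intro div2I [of "int j" _ _ "- ((-1) ^ Suc i)"]) simp_all
  then show ?thesis
    by (rule div2_mono) (use weight_bound [of i] in \<open>simp add: v_def\<close>)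
qed

lemma log_tail_power_div2: "div2 (int (weight i)) ((log_tail ^ S) $ i)"
proof (induction S arbitrary: i)
  case 0
  show ?case
    using div2_of_nat [of 1] by (cases "i = 0") (auto simp: weight_def)
next
  case (Suc S)
  have "div2 (int (weight i)) (log_tail $ j * (log_tail ^ S) $ (i - j))" if "j \<le> i" for j
    using div2_mult [OF log_tail_div2 [of j] Suc.IH [of "i - j"]]
    by (rule div2_mono) (use weight_add_le [of j "i - j"] that in simp)
  then show ?case
    by (auto simp: fps_mult_nth intro!: div2_sum)
qed

text \<open>Modulo 4 the linear coefficient -4/3 vanishes, so only the \<open>S\<close> choices of
  the quadratic coefficient 2 contribute.\<close>

lemma log_tail_power_nth_2: "div2 2 ((log_tail ^ S) $ 2 - 2 * of_nat S)"
proof (induction S)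
  case (Suc S)
  have "(log_tail ^ Suc S) $ 2 = (log_tail ^ S) $ 2 - 4 / 3 * (log_tail ^ S) $ 1 + 2"
    by (simp add: fps_mult_nth numeral_2_eq_2 log_tail_nth [unfolded numeral_2_eq_2 One_nat_def] fps_nth_power_0)
  then have *: "(log_tail ^ Suc S) $ 2 - 2 * of_nat (Suc S) =
      ((log_tail ^ S) $ 2 - 2 * of_nat S) + (- (4 / 3)) * (log_tail ^ S) $ 1"
    by simp
  have "div2 2 (- (4 / 3))"
    by (rule div2I [of 3 _ _ "-1"]) auto
  then have "div2 (2 + int (weight 1)) (- (4 / 3) * (log_tail ^ S) $ 1)"
    using log_tail_power_div2 by (rule div2_mult)
  then have "div2 2 (- (4 / 3) * (log_tail ^ S) $ 1)"
    by (rule div2_mono) simp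
  then show ?case
    unfolding * using Suc by (rule div2_add [rotated])
qed simp

text \<open>The negative binomial series of (1 - x)^(-N-1), composed with x = u
  \<open>log_tail\<close>; the factor u^S cuts the sum off at \<open>d\<close>.\<close>

lemma inverse_log_series_power_nth:
  "(inverse log_series ^ Suc N) $ d = (\<Sum>S = 0..d. of_nat ((N + S) choose N) * (log_tail ^ S) $ (d - S))"
proof -
  have "inverse log_series ^ Suc N = inverse ((1 - fps_X) ^ Suc N oo (fps_X * log_tail))"
  proof -
    have "log_series = (1 - fps_X) oo (fps_X * log_tail)"
      by (simp add: log_series_eq fps_compose_sub_distrib)
    moreover have "(1 - fps_X) ^ Suc N oo (fps_X * log_tail) = ((1 - fps_X) oo (fps_X * log_tail)) ^ Suc N"
      by (rule fps_compose_power [symmetric]) simp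
    ultimately show ?thesis
      by (simp only: fps_inverse_power)
  qed
  also have "\<dots> = inverse ((1 - fps_const 1 * fps_X) ^ Suc N) oo (fps_X * log_tail)"
    by (subst fps_inverse_compose) (simp_all add: fps_nth_power_0 del: power_Suc)
  also have "\<dots> = Abs_fps (\<lambda>S. of_nat ((N + S) choose N)) oo (fps_X * log_tail)"
    by (subst one_minus_const_fps_X_neg_power') (auto simp: binomial_symmetric [of N "N + _"])
  finally have "inverse log_series ^ Suc N = Abs_fps (\<lambda>S. of_nat ((N + S) choose N)) oo (fps_X * log_tail)" .
  then show ?thesis
    by (auto simp: fps_compose_nth power_mult_distrib fps_X_power_mult_nth simp del: power_Suc intro!: sum.cong)
qed

subsection \<open>Congruences for the two coefficients\<close>

abbreviation overlap :: "nat \<Rightarrow> nat \<Rightarrow> int" where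
  "overlap N d \<equiv> int (sigma (and N d))"

definition binom :: "nat \<Rightarrow> nat \<Rightarrow> rat" where
  "binom N d = of_nat ((N + d) choose N)"

lemma exact2_binom_iff: "exact2 m (binom N d) \<longleftrightarrow> nu ((N + d) choose N) = Fin m"
  by (simp add: binom_def exact2_of_nat_iff)

text \<open>Kummer's theorem in digit-sum form, from Legendre's formula for the three
  factorials.\<close>

lemma multiplicity_2_choose:
  "multiplicity 2 ((N + S) choose N) + sigma (N + S) = sigma N + sigma S"
proof -
  have "fact N * fact S * ((N + S) choose N) = (fact (N + S) :: nat)"
    using binomial_fact_lemma [of N "N + S"] by simp
  then have "multiplicity 2 (fact (N + S) :: nat) =
      multiplicity 2 (fact N * fact S * ((N + S) choose N) :: nat)"
    by simp
  also have "\<dots> = multiplicity 2 (fact N :: nat) + multiplicity 2 (fact S :: nat) +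
      multiplicity 2 ((N + S) choose N)"
    by (simp add: prime_elem_multiplicity_mult_distrib)
  finally show ?thesis
    using multiplicity_2_fact [of N] multiplicity_2_fact [of S] multiplicity_2_fact [of "N + S"]
    by linarith
qed

lemma binom_exact2: "exact2 (int (sigma N + sigma S) - int (sigma (N + S))) (binom N S)"
  using multiplicity_2_choose [of N S] by (simp add: exact2_binom_iff nu_def)

lemma binom_div2: "div2 (overlap N S) (binom N S)"
proof (rule div2_mono)
  show "div2 (int (sigma N + sigma S) - int (sigma (N + S))) (binom N S)"
    using binom_exact2 [of N S] by (simp add: exact2_def)
qed (use sigma_add_and_le [of N S] in linarith)

lemma binom_div2_0: "div2 0 (binom N d)"
  by (simp add: binom_def)

lemma binom_odd_iff: "exact2 0 (binom N S) \<longleftrightarrow> and N S = 0"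
proof
  assume "exact2 0 (binom N S)"
  then have "sigma N + sigma S = sigma (N + S)"
    using exact2_unique [OF binom_exact2 [of N S]] by fastforce
  then show "and N S = 0"
    using sigma_add_and_le [of N S] by simp
next
  assume "and N S = 0"
  then show "exact2 0 (binom N S)"
    using binom_exact2 [of N S] by (simp add: sigma_add_disjoint)
qed

lemma overlap_le: "S \<le> d \<Longrightarrow> overlap N d \<le> overlap N S + int (sigma (d - S))"
  using sigma_and_le_diff [of S d N] by linarith

text \<open>For \<open>N = n - 1\<close> this is the coefficient of the shifted formula; for
  \<open>N = n\<close> it is the ingredient of \<open>main_coeff\<close> before multiplication by 1
  / (1 + 2 u).\<close>

definition shifted_coeff :: "nat \<Rightarrow> nat \<Rightarrow> rat" where
  "shifted_coeff N d = (inverse log_series ^ Suc N) $ d"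

definition main_coeff :: "nat \<Rightarrow> nat \<Rightarrow> rat" where
  "main_coeff n d = (inverse log_series ^ Suc n * geom_series) $ d"

text \<open>The term \<open>S = d - 2\<close> of the expansion with its \<open>log_tail\<close>
  coefficient reduced modulo 4. The guard prevents truncated subtraction from inventing a
  term.\<close>

definition corr_two :: "nat \<Rightarrow> nat \<Rightarrow> rat" where
  "corr_two N d = (if d < 2 then 0 else 2 * of_nat (d - 2) * binom N (d - 2))"

lemma corr_two_eq: "2 \<le> d \<Longrightarrow> corr_two N d = 2 * of_nat (d - 2) * binom N (d - 2)"
  unfolding corr_two_def by simp

definition corr_one :: "nat \<Rightarrow> nat \<Rightarrow> rat" where
  "corr_one N d = (if d = 0 then 0 else - 2 * binom N (d - 1))"

lemma sum_two_last:
  fixes f :: "nat \<Rightarrow> 'a :: comm_monoid_add"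
  assumes "c \<noteq> 0"
  shows "(\<Sum>S = 0..d. (if S = d then f S else 0) + (if S + c = d then g S else 0)) =
    f d + (if d < c then 0 else g (d - c))"
proof -
  have "(\<Sum>S = 0..d. if S + c = d then g S else 0) =
      (\<Sum>S = 0..d. if S = d - c then (if d < c then 0 else g S) else 0)"
    using assms by (intro sum.cong) auto
  then show ?thesis
    by (simp add: sum.distrib)
qed

text \<open>In the term with index \<open>S\<close>, the digits lost in passing from
  \<open>d\<close> to \<open>S\<close> are repaid by the valuation of the \<open>log_tail\<close>
  factor.\<close>

lemma shifted_coeff_div2: "div2 (overlap N d) (shifted_coeff N d)"
proof -
  have "div2 (overlap N d) (binom N S * (log_tail ^ S) $ (d - S))" if "S \<le> d" for S
    using div2_mult [OF binom_div2 [of N S] log_tail_power_div2 [of "d - S" S]]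
    by (rule div2_mono) (use overlap_le [OF that, of N] sigma_le_weight [of "d - S"] in linarith)
  then show ?thesis
    unfolding shifted_coeff_def inverse_log_series_power_nth binom_def [symmetric] by (intro div2_sum) simp
qed

text \<open>The weight of \<open>d - S\<close> exceeds its digit sum unless the difference is 0 or
  2, so all other terms gain an extra factor 2.\<close>

lemma shifted_coeff_cong:
  "div2 (overlap N d + 1) (shifted_coeff N d - (binom N d + corr_two N d))"
proof -
  have "div2 (overlap N d + 1) (binom N S * (log_tail ^ S) $ (d - S) -
      ((if S = d then binom N S else 0) + (if S + 2 = d then 2 * of_nat S * binom N S else 0)))"
    (is "div2 _ ?D") if "S \<le> d" for S
  proof -
    consider "S = d" | "S + 2 = d" | "S \<noteq> d" "S + 2 \<noteq> d"
      by blast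
    then show ?thesis
    proof cases
      case 1
      then show ?thesis
        by (simp add: fps_nth_power_0 log_tail_nth)
    next
      case 2
      \<comment> \<open>Passing from \<open>d - 2\<close> to \<open>d\<close> gains at most one
        shared digit, so knowing the coefficient modulo 4 is enough.\<close>
      then have "?D = binom N S * ((log_tail ^ S) $ 2 - 2 * of_nat S)"
        by (auto simp: algebra_simps)
      then show ?thesis
        using div2_mult [OF binom_div2 [of N S] log_tail_power_nth_2 [of S]] overlap_le [OF that, of N] 2
        by (auto elim!: div2_mono simp: sigma.simps [of 2])
    next
      case 3
      then have "div2 (overlap N S + int (weight (d - S))) ?D"
        using div2_mult [OF binom_div2 [of N S] log_tail_power_div2 [of "d - S" S]] by simp
      then show ?thesis
        by (rule div2_mono) (use 3 that overlap_le [OF that, of N] in \<open>auto simp: weight_def\<close>)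
    qed
  qed
  then have "div2 (overlap N d + 1) (\<Sum>S = 0..d. binom N S * (log_tail ^ S) $ (d - S) -
      ((if S = d then binom N S else 0) + (if S + 2 = d then 2 * of_nat S * binom N S else 0)))"
    by (intro div2_sum) simp
  then show ?thesis
    unfolding sum_subtractf shifted_coeff_def inverse_log_series_power_nth binom_def [symmetric]
    by (subst (asm) sum_two_last) (simp_all add: corr_two_def)
qed

lemma corr_two_div2_1: "div2 1 (corr_two N d)"
proof (cases "d < 2")
  case False
  have "div2 (1 + 0 + 0) (2 * of_nat (d - 2) * binom N (d - 2))"
    by (intro div2_mult div2_numeral_2 binom_div2_0 div2_of_nat)
  then show ?thesis
    using False by (simp only: corr_two_eq not_less add_0_right)
qed (simp add: corr_two_def)

lemma corr_two_div2: "div2 (overlap N d) (corr_two N d)"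
proof (cases "d < 2")
  case False
  have "div2 (1 + 0 + overlap N (d - 2)) (corr_two N d)"
    using False by (simp only: corr_two_eq not_less) (intro div2_mult div2_numeral_2 div2_of_nat binom_div2)
  then show ?thesis
    by (rule div2_mono) (use False overlap_le [of "d - 2" d N] in \<open>simp add: sigma.simps [of 2]\<close>)
qed (simp add: corr_two_def)

lemma corr_two_even:
  assumes "even d"
  shows "div2 (overlap N d + 1) (corr_two N d)"
proof (cases "d < 2")
  case False
  have "even (int (d - 2))"
    using assms False by simp
  then have "div2 1 (of_int (int (d - 2)))"
    by (rule div2_1_even)
  then have "div2 (1 + 1 + overlap N (d - 2)) (2 * of_nat (d - 2) * binom N (d - 2))"
    unfolding of_int_of_nat_eq by (intro div2_mult div2_numeral_2 binom_div2)
  then have "div2 (1 + 1 + overlap N (d - 2)) (corr_two N d)"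
    using False by (simp only: corr_two_eq not_less)
  then show ?thesis
    by (rule div2_mono) (use False overlap_le [of "d - 2" d N] in \<open>simp add: sigma.simps [of 2]\<close>)
qed (simp add: corr_two_def)

text \<open>For odd \<open>d\<close> the factor 2 (d - 2) has valuation exactly 1, whence the
  \<open>- 1\<close>; for even \<open>d\<close> a second factor 2 makes the term negligible.\<close>

lemma exact2_corr_two_iff:
  "exact2 (overlap N d) (corr_two N d) \<longleftrightarrow>
    odd d \<and> 2 \<le> d \<and> nu ((N + d - 2) choose N) = Fin (overlap N d - 1)"
proof -
  consider "even d" | "d < 2" | "odd d" "2 \<le> d"
    by linarith
  then show ?thesis
  proof cases
    case 1
    then show ?thesis
      using corr_two_even by (auto simp: exact2_def)
  next
    case 2
    then show ?thesis
      by (auto simp: exact2_def corr_two_def)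
  next
    case 3
    have "exact2 (1 + 0) (2 * of_nat (d - 2))"
      using 3 exact2_odd_of_nat [of "d - 2"] by (subst exact2_mult_iff [OF exact2_numeral_2]) auto
    then have "exact2 (1 + 0 + (overlap N d - 1)) (corr_two N d) \<longleftrightarrow> exact2 (overlap N d - 1) (binom N (d - 2))"
      using 3 unfolding corr_two_def by (subst exact2_mult_iff [symmetric]) auto
    then show ?thesis
      using 3 by (simp add: exact2_binom_iff)
  qed
qed

lemma exact2_shifted_coeff_iff:
  "exact2 (overlap N d) (shifted_coeff N d) \<longleftrightarrow>
    (nu ((N + d) choose N) = Fin (overlap N d)) \<noteq>
    (odd d \<and> 2 \<le> d \<and> nu ((N + d - 2) choose N) = Fin (overlap N d - 1))"
  using exact2_cong [OF shifted_coeff_cong [of N d]] exact2_add [OF binom_div2 corr_two_div2, of N d]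
  by (simp add: exact2_corr_two_iff exact2_binom_iff)

text \<open>Modulo 2 the correction disappears and only the binomial coefficient is left.\<close>

lemma shifted_coeff_odd_iff: "exact2 0 (shifted_coeff N d) \<longleftrightarrow> and N d = 0"
proof -
  have "div2 1 (shifted_coeff N d - (binom N d + corr_two N d))"
    using shifted_coeff_cong by (rule div2_mono) simp
  then have "div2 1 (shifted_coeff N d - (binom N d + corr_two N d) + corr_two N d)"
    using corr_two_div2_1 by (rule div2_add)
  then have "exact2 0 (shifted_coeff N d) \<longleftrightarrow> exact2 0 (binom N d)"
    by (intro exact2_cong) simp
  then show ?thesis
    by (simp add: binom_odd_iff)
qed

section \<open>The coefficient with the additional factor 1 / (1 + 2 u)\<close>

lemma overlap_double_le: "overlap N (2 * m) \<le> overlap N (Suc (2 * m))"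
  by (rule nat_last_bit [of N]) (auto simp: and_double_nat)

text \<open>Shows that the correction inside \<open>shifted_coeff n (d - 1)\<close> is negligible
  once multiplied by the -2 from \<open>geom_series\<close>. For odd \<open>d\<close> this follows
  from \<open>d - 1\<close> being even.\<close>

lemma corr_two_pred:
  assumes "0 < d"
  shows "div2 (overlap n d + 1) (2 * corr_two n (d - 1))"
proof (cases "odd d")
  case True
  have "div2 (1 + (overlap n (d - 1) + 1)) (2 * corr_two n (d - 1))"
    using True by (intro div2_mult div2_numeral_2 corr_two_even) simp
  then show ?thesis
    by (rule div2_mono) (use assms overlap_le [of "d - 1" d n] in simp)
next
  case False
  show ?thesis
  proof (cases "d < 3")
    case True
    then show ?thesis
      by (simp add: corr_two_def)
  next
    case d: False
    txt \<open>The general bound would lose 2 in passing from \<open>d - 3\<close> to \<open>d\<close>; going through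
      \<open>d - 4\<close>, which differs from \<open>d\<close> by a single power of 2, loses only 1.\<close>
    then obtain m where m: "d = 2 * m + 4"
      using \<open>\<not> odd d\<close> by (auto elim!: evenE intro: that [of "d div 2 - 2"])
    have "corr_two n (d - 1) = 2 * of_nat (Suc (2 * m)) * binom n (Suc (2 * m))"
      by (simp add: m corr_two_def eval_nat_numeral)
    moreover have "div2 (1 + (1 + 0 + overlap n (Suc (2 * m))))
        (2 * (2 * of_nat (Suc (2 * m)) * binom n (Suc (2 * m))))"
      by (intro div2_mult div2_numeral_2 div2_of_nat binom_div2)
    moreover have "overlap n d \<le> overlap n (2 * m) + 1"
      using overlap_le [of "2 * m" d n] by (simp add: m sigma.simps [of 4] sigma.simps [of 2])
    ultimately show ?thesis
      using overlap_double_le [of n m] by (auto elim!: div2_mono)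
  qed
qed

lemma corr_one_div2_1: "div2 1 (corr_one N d)"
  using div2_minus [OF div2_mult [OF div2_numeral_2 binom_div2_0 [of N "d - 1"]]]
  by (simp add: corr_one_def)

lemma corr_one_div2: "div2 (overlap N d) (corr_one N d)"
proof (cases "d = 0")
  case False
  have "div2 (1 + overlap N (d - 1)) (2 * binom N (d - 1))"
    by (intro div2_mult div2_numeral_2 binom_div2)
  then have "div2 (overlap N d) (2 * binom N (d - 1))"
    by (rule div2_mono) (use False overlap_le [of "d - 1" d N] in simp)
  then show ?thesis
    using False div2_minus by (fastforce simp: corr_one_def)
qed (simp add: corr_one_def)

text \<open>The coefficient of \<open>geom_series\<close> at i has valuation i, which exceeds the
  digit sum of i for i at least 2; only i = 0 and i = 1 survive.\<close>

lemma main_coeff_cong_shifted: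
  "div2 (overlap n d + 1)
    (main_coeff n d - (shifted_coeff n d + (if d < 1 then 0 else - 2 * shifted_coeff n (d - 1))))"
proof -
  have "div2 (overlap n d + 1) (shifted_coeff n S * geom_series $ (d - S) -
      ((if S = d then shifted_coeff n S else 0) + (if S + 1 = d then - 2 * shifted_coeff n S else 0)))"
    (is "div2 _ ?D") if S: "S \<le> d" for S
  proof -
    consider "S = d" | "S + 1 = d" | "S + 2 \<le> d"
      using S by linarith
    then show ?thesis
    proof cases
      case 3
      have "div2 (int (d - S)) (geom_series $ (d - S))"
        by (rule div2I [of 1 _ _ "(- 1) ^ (d - S)"]) (auto simp: geom_series_def power_minus [of 2])
      then have "div2 (overlap n S + int (d - S)) ?D"
        using div2_mult [OF shifted_coeff_div2 [of n S]] 3 by simp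
      then show ?thesis
        by (rule div2_mono) (use 3 overlap_le [OF that, of n] sigma_less [of "d - S"] in linarith)
    qed (auto simp: geom_series_def)
  qed
  then have "div2 (overlap n d + 1) (\<Sum>S = 0..d. shifted_coeff n S * geom_series $ (d - S) -
      ((if S = d then shifted_coeff n S else 0) + (if S + 1 = d then - 2 * shifted_coeff n S else 0)))"
    by (intro div2_sum) simp
  moreover have "main_coeff n d = (\<Sum>S = 0..d. shifted_coeff n S * geom_series $ (d - S))"
    unfolding main_coeff_def shifted_coeff_def by (rule fps_mult_nth)
  ultimately show ?thesis
    unfolding sum_subtractf by (subst (asm) sum_two_last) simp_all
qed

lemma main_coeff_cong:
  "div2 (overlap n d + 1) (main_coeff n d - (binom n d + (corr_one n d + corr_two n d)))"
proof -
  define E where "E = (if d < 1 then 0 else - 2 * shifted_coeff n (d - 1))"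
  have "div2 (overlap n d + 1) (E - corr_one n d)"
  proof (cases "d = 0")
    case False
    have "div2 (1 + (overlap n (d - 1) + 1))
        (2 * (shifted_coeff n (d - 1) - (binom n (d - 1) + corr_two n (d - 1))))"
      by (intro div2_mult div2_numeral_2 shifted_coeff_cong)
    then have "div2 (overlap n d + 1)
        (2 * (shifted_coeff n (d - 1) - (binom n (d - 1) + corr_two n (d - 1))))"
      by (rule div2_mono) (use False overlap_le [of "d - 1" d n] in simp)
    then have "div2 (overlap n d + 1)
        (- (2 * (shifted_coeff n (d - 1) - (binom n (d - 1) + corr_two n (d - 1))) + 2 * corr_two n (d - 1)))"
      using False by (intro div2_minus div2_add corr_two_pred) auto
    then show ?thesis
      using False by (simp add: E_def corr_one_def algebra_simps)
  qed (simp add: E_def corr_one_def)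
  then have "div2 (overlap n d + 1) ((main_coeff n d - (shifted_coeff n d + E)) +
      (shifted_coeff n d - (binom n d + corr_two n d)) + (E - corr_one n d))"
    using main_coeff_cong_shifted shifted_coeff_cong unfolding E_def by (intro div2_add)
  then show ?thesis
    by (simp add: algebra_simps)
qed

lemma exact2_corr_one_iff:
  assumes "0 < d"
  shows "exact2 (overlap n d) (corr_one n d) \<longleftrightarrow> nu ((n + d - 1) choose n) = Fin (overlap n d - 1)"
proof -
  have "exact2 (1 + (overlap n d - 1)) (2 * binom n (d - 1)) \<longleftrightarrow>
      exact2 (overlap n d - 1) (binom n (d - 1))"
    by (rule exact2_mult_iff [OF exact2_numeral_2])
  then show ?thesis
    using assms by (simp add: corr_one_def exact2_minus exact2_binom_iff)
qed

lemma exact2_main_coeff_iff: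
  assumes "0 < d"
  shows "exact2 (overlap n d) (main_coeff n d) \<longleftrightarrow>
    (nu ((n + d) choose n) = Fin (overlap n d)) \<noteq>
    ((nu ((n + d - 1) choose n) = Fin (overlap n d - 1)) \<noteq>
     (odd d \<and> 2 \<le> d \<and> nu ((n + d - 2) choose n) = Fin (overlap n d - 1)))"
  using exact2_cong [OF main_coeff_cong [of n d]]
    exact2_add [OF binom_div2 div2_add [OF corr_one_div2 corr_two_div2], of n d]
    exact2_add [OF corr_one_div2 corr_two_div2, of n d] exact2_corr_one_iff [OF assms, of n]
  by (simp add: exact2_corr_two_iff exact2_binom_iff)

lemma main_coeff_odd_iff: "exact2 0 (main_coeff n d) \<longleftrightarrow> and n d = 0"
proof -
  have "div2 1 (main_coeff n d - (binom n d + (corr_one n d + corr_two n d)))"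
    using main_coeff_cong by (rule div2_mono) simp
  then have "div2 1 (main_coeff n d - (binom n d + (corr_one n d + corr_two n d)) + (corr_one n d + corr_two n d))"
    using corr_one_div2_1 corr_two_div2_1 by (intro div2_add)
  then have "exact2 0 (main_coeff n d) \<longleftrightarrow> exact2 0 (binom n d)"
    by (intro exact2_cong) simp
  then show ?thesis
    by (simp add: binom_odd_iff)
qed

lemma binom_absorb:
  assumes "0 < d"
  shows "of_nat d * binom n d = of_nat (n + d) * binom n (d - 1)"
proof -
  obtain e where e: "d = Suc e"
    using assms gr0_conv_Suc by blast
  have "Suc e * ((n + Suc e) choose n) = (n + Suc e) * ((n + e) choose n)"
    using Suc_times_binomial_eq [of "n + e" e]
      binomial_symmetric [of n "n + Suc e"] binomial_symmetric [of n "n + e"]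
    by (simp del: binomial_Suc_Suc)
  then show ?thesis
    unfolding e binom_def of_nat_mult [symmetric] by (simp only: diff_Suc_1)
qed

text \<open>Absorption at \<open>d\<close> compares levels \<open>r\<close> and
  \<open>r - 1\<close>, which makes \<open>n + d\<close> even and hence \<open>n\<close> odd.
  Absorption at \<open>d - 1\<close> then equates a term of valuation \<open>r - 1\<close> with one
  divisible by 2^r, because \<open>d - 1\<close> is even.\<close>

lemma not_three_exact2:
  assumes "odd d" "2 \<le> d" "exact2 r (binom n d)" "exact2 (r - 1) (binom n (d - 1))"
  shows "\<not> exact2 (r - 1) (binom n (d - 2))"
proof
  assume *: "exact2 (r - 1) (binom n (d - 2))"
  have "exact2 (0 + r) (of_nat d * binom n d)"
    using exact2_mult_iff [OF exact2_odd_of_nat] assms by blast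
  then have 1: "exact2 r (of_nat (n + d) * binom n (d - 1))"
    using assms by (simp add: binom_absorb)
  have "odd n"
  proof
    assume "even n"
    then have "exact2 (0 + (r - 1)) (of_nat (n + d) * binom n (d - 1))"
      using assms by (subst exact2_mult_iff [OF exact2_odd_of_nat]) auto
    then show False
      using exact2_unique [OF 1] by fastforce
  qed
  then have "exact2 (0 + (r - 1)) (of_nat (n + (d - 1)) * binom n (d - 2))"
    using assms * by (subst exact2_mult_iff [OF exact2_odd_of_nat]) auto
  moreover have "d - 1 - 1 = d - 2"
    by simp
  ultimately have "exact2 (r - 1) (of_nat (d - 1) * binom n (d - 1))"
    using assms binom_absorb [of "d - 1" n] by simp
  moreover have "div2 (1 + (r - 1)) (of_nat (d - 1) * binom n (d - 1))"
    using assms div2_1_even [of "int (d - 1)"] by (intro div2_mult) (auto simp: exact2_def)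
  ultimately show False
    by (simp add: exact2_def)
qed

subsection \<open>Valuations of Stirling numbers\<close>

lemma fact_exact2: "exact2 (int n - int (sigma n)) (fact n)"
proof -
  have "exact2 (int n - int (sigma n)) (of_nat (fact n))"
    using multiplicity_2_fact [of n] by (simp only: exact2_of_nat_iff) (simp add: nu_def)
  then show ?thesis
    by simp
qed

text \<open>By Legendre's formula 2^(n-k) k! has valuation n - sigma(k) and n! has n - sigma(n); the
  n cancels. A general \<open>s\<close> lets the same argument serve the indices lowered by
  1.\<close>

lemma nu_eq_of_fact:
  assumes "of_nat s * 2 ^ (n - k) * fact k = fact n * c" "k \<le> n"
  shows "nu s = Fin (int (sigma k) - int (sigma n) + r) \<longleftrightarrow> exact2 r c"
proof -
  have "exact2 (int (n - k)) (2 powi int (n - k))"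
    unfolding exact2_representation by (intro exI [of _ 1]) simp
  then have "exact2 (int (n - k) + (int k - int (sigma k))) (2 ^ (n - k) * fact k)"
    by (subst exact2_mult_iff) (simp_all add: fact_exact2)
  then have "exact2 (int (n - k) + (int k - int (sigma k)) + m) (2 ^ (n - k) * fact k * of_nat s)
      \<longleftrightarrow> nu s = Fin m" for m
    by (subst exact2_mult_iff) (simp_all add: exact2_of_nat_iff)
  moreover have "exact2 (int n - int (sigma n) + r) (fact n * c) \<longleftrightarrow> exact2 r c"
    by (rule exact2_mult_iff [OF fact_exact2])
  moreover have "2 ^ (n - k) * fact k * of_nat s = fact n * c"
    using assms by (simp add: mult_ac)
  moreover have "int n - int (sigma n) + r =
      int (n - k) + (int k - int (sigma k)) + (int (sigma k) - int (sigma n) + r)"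
    using assms by simp
  ultimately show ?thesis
    by metis
qed

lemma nu_Stirling_eq_iff:
  assumes "k \<le> n"
  shows "nu (Stirling n k) = Fin (int (sigma k) - int (sigma n) + r) \<longleftrightarrow>
    exact2 r (main_coeff n (n - k))"
  unfolding main_coeff_def using Stirling_eq_coeff [OF assms] assms by (rule nu_eq_of_fact)

lemma nu_Stirling_eq_iff_shifted:
  assumes "1 \<le> k" "k \<le> n"
  shows "nu (Stirling n k) = Fin (int (sigma (k - 1)) - int (sigma (n - 1)) + r) \<longleftrightarrow>
    exact2 r (shifted_coeff (n - 1) (n - k))"
proof (rule nu_eq_of_fact)
  have nk: "fact n = of_nat n * (fact (n - 1) :: rat)" "fact k = of_nat k * (fact (k - 1) :: rat)"
    using assms by (auto simp: fact_reduce)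
  have "of_nat k * (of_nat (Stirling n k) * 2 ^ (n - k) * fact (k - 1)) =
      fact (n - 1) * (of_nat n * (inverse log_series ^ Suc n * geom_series) $ (n - k))"
    using Stirling_eq_coeff [OF assms(2)] by (simp only: nk mult_ac)
  also have "of_nat n * (inverse log_series ^ Suc n * geom_series) $ (n - k) =
      of_nat k * shifted_coeff (n - 1) (n - k)"
    using nth_inverse_log_series_power [of "n - k" n] assms by (simp add: shifted_coeff_def)
  also have "fact (n - 1) * (of_nat k * shifted_coeff (n - 1) (n - k)) =
      of_nat k * (fact (n - 1) * shifted_coeff (n - 1) (n - k))"
    by simp
  \<comment> \<open>The common factor \<open>k\<close> is cancelled, which uses that
    \<open>k\<close> is positive.\<close>
  finally show "of_nat (Stirling n k) * 2 ^ (n - 1 - (k - 1)) * fact (k - 1) =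
      fact (n - 1) * shifted_coeff (n - 1) (n - k)"
    using assms by simp
qed (use assms in simp)

lemma precisely_one_iff: "precisely_one Ps \<longleftrightarrow> length (filter id Ps) = 1"
proof -
  have "(\<exists>!i. i < length Ps \<and> Ps ! i) \<longleftrightarrow> (\<exists>i. {i. i < length Ps \<and> id (Ps ! i)} = {i})"
    unfolding Ex1_def id_def set_eq_iff mem_Collect_eq singleton_iff
    by (intro arg_cong [where f = Ex] ext) blast
  then show ?thesis
    unfolding precisely_one_def length_filter_conv_card by (simp add: card_1_singleton_iff)
qed

lemma precisely_one_2: "precisely_one [a, b] \<longleftrightarrow> a \<noteq> b"
  by (simp add: precisely_one_iff)

text \<open>The congruences determine only a parity, and an odd count among three differs from
  exactly one just when all three hold.\<close>

lemma precisely_one_3: "precisely_one [a, b, c] \<longleftrightarrow> (a \<noteq> (b \<noteq> c)) \<and> \<not> (a \<and> b \<and> c)"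
  by (simp add: precisely_one_iff)

text \<open>For \<open>d = 1\<close> and \<open>N = 0\<close> the truncated index \<open>N + d - 2\<close> would give the binomial
  coefficient 1 instead of 0.\<close>

lemma truncated_condition_iff:
  assumes "and N d \<noteq> 0"
  shows "odd d \<and> nu ((N + d - 2) choose N) = Fin m \<longleftrightarrow>
    odd d \<and> 2 \<le> d \<and> nu ((N + d - 2) choose N) = Fin m"
proof -
  have "N \<noteq> 0"
    using assms by (cases "N = 0") auto
  have "nu ((N + d - 2) choose N) \<noteq> Fin m" if "odd d" "\<not> 2 \<le> d"
  proof -
    have "d = 1"
      using that by (cases d) auto
    then have "(N + d - 2) choose N = 0"
      using \<open>N \<noteq> 0\<close> by simp
    then show ?thesis
      by (simp add: nu_def)
  qed
  then show ?thesis
    by blast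
qed

theorem theorem3p3:
  fixes n k :: nat
  assumes "1 \<le> k" and "k \<le> n"
  shows "(MZC n k \<longleftrightarrow> binpows (n - k) \<inter> binpows n = {}) \<and>
    (SMZC n k \<longleftrightarrow> binpows (n - k) \<inter> binpows (n - 1) = {}) \<and>
    (AMZC n k \<longleftrightarrow> binpows (n - k) \<inter> binpows n \<noteq> {} \<and>
       precisely_one
         [nu ((n + (n - k)) choose n) = Fin (common n (n - k)),
          nu ((n + (n - k) - 1) choose n) = Fin (common n (n - k) - 1),
          odd (n - k) \<and> nu ((n + (n - k) - 2) choose n) = Fin (common n (n - k) - 1)]) \<and>
    (SAMZC n k \<longleftrightarrow> binpows (n - k) \<inter> binpows (n - 1) \<noteq> {} \<and>
       precisely_one
         [nu (((n - 1) + (n - k)) choose (n - 1)) = Fin (common (n - 1) (n - k)),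
          odd (n - k) \<and>
            nu (((n - 1) + (n - k) - 2) choose (n - 1)) = Fin (common (n - 1) (n - k) - 1)])"
proof -
  define d where "d = n - k"
  have disjoint: "binpows d \<inter> binpows N = {} \<longleftrightarrow> and N d = 0" for N
    by (simp add: binpows_disjoint_iff and.commute)
  have MZC: "MZC n k \<longleftrightarrow> and n d = 0"
    using nu_Stirling_eq_iff [OF assms(2), of 0] by (simp add: MZC_def main_coeff_odd_iff d_def)
  have SMZC: "SMZC n k \<longleftrightarrow> and (n - 1) d = 0"
    using nu_Stirling_eq_iff_shifted [OF assms, of 0]
    by (simp add: SMZC_def shifted_coeff_odd_iff d_def)
  have AMZC: "AMZC n k \<longleftrightarrow> and n d \<noteq> 0 \<and> exact2 (overlap n d) (main_coeff n d)"
    using nu_Stirling_eq_iff [OF assms(2), of "overlap n d"] MZC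
    by (simp add: AMZC_def common_eq d_def)
  have SAMZC: "SAMZC n k \<longleftrightarrow>
      and (n - 1) d \<noteq> 0 \<and> exact2 (overlap (n - 1) d) (shifted_coeff (n - 1) d)"
    using nu_Stirling_eq_iff_shifted [OF assms, of "overlap (n - 1) d"] SMZC
    by (simp add: SAMZC_def common_eq d_def)
  have main: "exact2 (overlap n d) (main_coeff n d) \<longleftrightarrow>
      precisely_one
         [nu ((n + d) choose n) = Fin (common n d),
          nu ((n + d - 1) choose n) = Fin (common n d - 1),
          odd d \<and> nu ((n + d - 2) choose n) = Fin (common n d - 1)]" if "and n d \<noteq> 0"
  proof -
    have "0 < d"
      using that by (cases "d = 0") auto
    \<comment> \<open>This excludes the one case in which parity and \<open>precisely_one\<close>
      disagree.\<close>
    have "\<not> (nu ((n + d) choose n) = Fin (overlap n d) \<and>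
        nu ((n + d - 1) choose n) = Fin (overlap n d - 1) \<and>
        odd d \<and> 2 \<le> d \<and> nu ((n + d - 2) choose n) = Fin (overlap n d - 1))"
      using not_three_exact2 [of d "overlap n d" n] by (auto simp: exact2_binom_iff)
    then show ?thesis
      unfolding precisely_one_3 truncated_condition_iff [OF that] common_eq
        exact2_main_coeff_iff [OF \<open>0 < d\<close>] by blast
  qed
  have shifted: "exact2 (overlap (n - 1) d) (shifted_coeff (n - 1) d) \<longleftrightarrow>
      precisely_one
         [nu (((n - 1) + d) choose (n - 1)) = Fin (common (n - 1) d),
          odd d \<and> nu (((n - 1) + d - 2) choose (n - 1)) = Fin (common (n - 1) d - 1)]"
    if "and (n - 1) d \<noteq> 0"
    unfolding precisely_one_2 truncated_condition_iff [OF that] common_eq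
      exact2_shifted_coeff_iff by blast
  show ?thesis
    unfolding d_def [symmetric] disjoint MZC SMZC AMZC SAMZC
    \<comment> \<open>\<open>conj_cong\<close> supplies the nonempty intersection as the hypothesis
      of \<open>main\<close> and \<open>shifted\<close>.\<close>
    by (intro conjI conj_cong refl main shifted)
qed

end
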